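(* Let $X$ be a complex Banach space and let $T\in L(X)$. (a) The following statements are equivalent: (i) $T$ is meromorphic; (ii) $\sigma_{\mathcal{DR}}(T)\subseteq\{0\}$; (iii) $L_T\in L(L(X))$ is meromorphic; (iv) $R_T\in L(L(X))$ is meromorphic. (b) Let $S$ and $T\in L(X)$. Then $ST$ is meromorphic if and only if $TS$ is meromorphic. (c) Let $F\in L(X)$ and suppose that there exists a positive integer $n$ such that $F^n$ has finite dimensional range and that $F$ commutes with $T$. Then, if $T$ is meromorphic, $T+F$ is meromorphic.
   Context: For a Banach space $Y$, $L(Y)$ is the Banach algebra of bounded linear operators on $Y$. For $T\in L(X)$, $L_T,R_T\in L(L(X))$ are the multiplication operators $L_T(S)=TS$, $R_T(S)=ST$. For a bounded operator $U\in L(Y)$, $\sigma(U)$ is its spectrum and $\Pi(U)$ is the set of poles of the resolvent of $U$, i.e. the isolated points of $\sigma(U)$ that are poles of the function $\lambda\mapsto(U-\lambda)^{-1}$. The operator $U$ is meromorphic if $\sigma(U)\setminus\{0\}\subseteq\Pi(U)$. An element $U\in L(Y)$ is Drazin invertible if there exist $V\in L(Y)$ and $m\in\mathbb N$ such that $U^mVU=U^m$, $VUV=V$ and $UV=VU$; the Drazin spectrum is $\sigma_{\mathcal{DR}}(U)=\{\lambda\in\mathbb C: U-\lambda \text{ is not Drazin invertible in } L(Y)\}$. *)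

theory Defs
  imports "HOL-Analysis.Analysis"
begin

section \<open>Complex Banach spaces\<close>

class complex_normed_vector = real_normed_vector +
  fixes scaleC :: "complex \<Rightarrow> 'a \<Rightarrow> 'a"  (infixr \<open>*\<^sub>C\<close> 75)
  assumes scaleC_add_right: "c *\<^sub>C (x + y) = c *\<^sub>C x + c *\<^sub>C y"
    and scaleC_add_left: "(c + d) *\<^sub>C x = c *\<^sub>C x + d *\<^sub>C x"
    and scaleC_scaleC: "c *\<^sub>C d *\<^sub>C x = (c * d) *\<^sub>C x"
    and scaleC_of_real: "complex_of_real r *\<^sub>C x = r *\<^sub>R x"
    and norm_scaleC: "norm (c *\<^sub>C x) = cmod c * norm x"

class cbanach = complex_normed_vector + banach

global_interpretation complex: vector_space "scaleC :: complex \<Rightarrow> 'a \<Rightarrow> 'a::complex_normed_vector"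
proof
  show "1 *\<^sub>C x = x" for x :: 'a
    using scaleC_of_real[of 1 x] by simp
qed (simp_all add: scaleC_add_right scaleC_add_left scaleC_scaleC)

lemma bounded_linear_scaleC: "bounded_linear (\<lambda>x::'a::complex_normed_vector. c *\<^sub>C x)"
proof (rule bounded_linear_intro[where K = "cmod c"])
  show "c *\<^sub>C r *\<^sub>R x = r *\<^sub>R c *\<^sub>C x" for r and x :: 'a
    by (simp add: scaleC_scaleC mult.commute flip: scaleC_of_real)
qed (simp_all add: scaleC_add_right norm_scaleC mult.commute)


section \<open>The Banach algebra of bounded operators\<close>

text \<open>
  The type \<open>'a bop\<close> is the algebra of bounded complex-linear operators on \<open>'a\<close>: those bounded
  real-linear maps (type \<open>blinfun\<close>) that commute with complex scalars. The norm is the operator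
  norm inherited from \<open>blinfun\<close>, and multiplication is composition. As \<open>'a bop\<close> is again a complex
  Banach space, \<open>'a bop bop\<close> is the algebra of operators on it. The zero space is allowed, hence
  \<open>monoid_mult\<close> rather than \<open>ring_1\<close>.
\<close>

typedef (overloaded) 'a bop =
  "{f :: 'a::complex_normed_vector \<Rightarrow>\<^sub>L 'a.
      \<forall>c x. blinfun_apply f (c *\<^sub>C x) = c *\<^sub>C blinfun_apply f x}"
  morphisms blinfun_of_bop Bop
  by (rule exI[of _ 0]) simp

setup_lifting type_definition_bop

lift_definition bop_apply :: "'a::complex_normed_vector bop \<Rightarrow> 'a \<Rightarrow> 'a" is blinfun_apply .

instantiation bop :: (complex_normed_vector) complex_normed_vector
begin

lift_definition norm_bop :: "'a bop \<Rightarrow> real" is norm .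

lift_definition zero_bop :: "'a bop" is 0
  by simp

lift_definition plus_bop :: "'a bop \<Rightarrow> 'a bop \<Rightarrow> 'a bop" is "(+)"
  by (simp add: blinfun.add_left scaleC_add_right)

lift_definition minus_bop :: "'a bop \<Rightarrow> 'a bop \<Rightarrow> 'a bop" is "(-)"
  by (simp add: blinfun.diff_left complex.scale_right_diff_distrib)

lift_definition uminus_bop :: "'a bop \<Rightarrow> 'a bop" is uminus
  by (simp add: blinfun.minus_left)

lift_definition scaleC_bop :: "complex \<Rightarrow> 'a bop \<Rightarrow> 'a bop"
  is "\<lambda>c f. Blinfun (\<lambda>x. c *\<^sub>C blinfun_apply f x)"
  by (simp add: bounded_linear_Blinfun_apply bounded_linear_compose[OF bounded_linear_scaleC]
      blinfun.bounded_linear_right scaleC_scaleC mult.commute)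

lift_definition scaleR_bop :: "real \<Rightarrow> 'a bop \<Rightarrow> 'a bop" is "(*\<^sub>R)"
  by (simp add: blinfun.scaleR_left scaleC_scaleC mult.commute flip: scaleC_of_real)

definition dist_bop :: "'a bop \<Rightarrow> 'a bop \<Rightarrow> real"
  where "dist_bop a b = norm (a - b)"

definition [code del]:
  "(uniformity :: ('a bop \<times> 'a bop) filter) = (INF e\<in>{0 <..}. principal {(x, y). dist x y < e})"

definition open_bop :: "'a bop set \<Rightarrow> bool"
  where [code del]: "open_bop S = (\<forall>x\<in>S. \<forall>\<^sub>F (x', y) in uniformity. x' = x \<longrightarrow> y \<in> S)"

definition sgn_bop :: "'a bop \<Rightarrow> 'a bop"
  where "sgn_bop x = scaleR (inverse (norm x)) x"

lemma bop_apply_scaleC: "bop_apply (c *\<^sub>C f) x = c *\<^sub>C bop_apply f x"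
  by transfer (simp add: bounded_linear_Blinfun_apply
      bounded_linear_compose[OF bounded_linear_scaleC] blinfun.bounded_linear_right)

lemma bop_eqI: "(\<And>x. bop_apply f x = bop_apply g x) \<Longrightarrow> f = g"
  by transfer (rule blinfun_eqI)

instance
proof
  fix a b :: "'a bop" and c d :: complex and r :: real
  show "dist a b = norm (a - b)" by (rule dist_bop_def)
  show "sgn a = inverse (norm a) *\<^sub>R a" by (rule sgn_bop_def)
  show "(uniformity :: ('a bop \<times> 'a bop) filter) =
      (INF e\<in>{0 <..}. principal {(x, y). dist x y < e})"
    by (rule uniformity_bop_def)
  show "open S = (\<forall>x\<in>S. \<forall>\<^sub>F (x', y) in uniformity. x' = x \<longrightarrow> y \<in> S)" for S :: "'a bop set"
    by (rule open_bop_def)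
  show "norm (a + b) \<le> norm a + norm b"
    by transfer (rule norm_triangle_ineq)
  have add: "bop_apply (f + g) x = bop_apply f x + bop_apply g x" for f g :: "'a bop" and x
    by transfer (rule blinfun.add_left)
  have scaleR: "bop_apply (r *\<^sub>R f) x = r *\<^sub>R bop_apply f x" for f :: "'a bop" and r x
    by transfer (rule blinfun.scaleR_left)
  show "c *\<^sub>C (a + b) = c *\<^sub>C a + c *\<^sub>C b"
    by (rule bop_eqI) (simp add: add bop_apply_scaleC scaleC_add_right)
  show "(c + d) *\<^sub>C a = c *\<^sub>C a + d *\<^sub>C a"
    by (rule bop_eqI) (simp add: add bop_apply_scaleC scaleC_add_left)
  show "c *\<^sub>C d *\<^sub>C a = (c * d) *\<^sub>C a"
    by (rule bop_eqI) (simp add: bop_apply_scaleC scaleC_scaleC)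
  show "complex_of_real r *\<^sub>C a = r *\<^sub>R a"
    by (rule bop_eqI) (simp add: scaleR bop_apply_scaleC scaleC_of_real)
  have le: "norm (c *\<^sub>C f) \<le> cmod c * norm f" for c and f :: "'a bop"
  proof (transfer, rule norm_blinfun_bound)
    fix c and f :: "'a \<Rightarrow>\<^sub>L 'a" and x
    show "norm (blinfun_apply (Blinfun (\<lambda>x. c *\<^sub>C blinfun_apply f x)) x) \<le> cmod c * norm f * norm x"
      by (simp add: bounded_linear_Blinfun_apply bounded_linear_compose[OF bounded_linear_scaleC]
          blinfun.bounded_linear_right norm_scaleC mult.assoc mult_left_mono norm_blinfun)
  qed simp
  show "norm (c *\<^sub>C a) = cmod c * norm a"
  proof (cases "c = 0")
    case True
    have "0 \<le> norm (c *\<^sub>C a)"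
      by transfer simp
    then show ?thesis using le[of c a] True by simp
  next
    case False
    have "a = inverse c *\<^sub>C c *\<^sub>C a"
      by (rule bop_eqI) (simp add: bop_apply_scaleC scaleC_scaleC False)
    then have "norm a \<le> cmod (inverse c) * norm (c *\<^sub>C a)"
      using le[of "inverse c" "c *\<^sub>C a"] by simp
    then have "cmod c * norm a \<le> norm (c *\<^sub>C a)"
      using False by (simp add: norm_divide field_simps)
    with le[of c a] show ?thesis by simp
  qed
qed (transfer, simp add: algebra_simps)+

end

instantiation bop :: (complex_normed_vector) "{monoid_mult, real_normed_algebra}"
begin

lift_definition one_bop :: "'a bop" is id_blinfun
  by simp

lift_definition times_bop :: "'a bop \<Rightarrow> 'a bop \<Rightarrow> 'a bop" is "(o\<^sub>L)"
  by simp

instance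
proof
  fix a b :: "'a bop"
  show "norm (a * b) \<le> norm a * norm b"
    by transfer (rule norm_blinfun_compose)
qed (transfer, rule blinfun_eqI, simp add: blinfun.bilinear_simps)+

end

lemma bop_apply_times: "bop_apply (f * g) x = bop_apply f (bop_apply g x)"
  by transfer simp

lemma bop_apply_scaleC_arg: "bop_apply f (c *\<^sub>C x) = c *\<^sub>C bop_apply f x"
  by transfer simp

instance bop :: (cbanach) cbanach
proof
  fix X :: "nat \<Rightarrow> 'a bop"
  assume "Cauchy X"
  have dist: "dist (blinfun_of_bop a) (blinfun_of_bop b) = dist a b" for a b :: "'a bop"
    unfolding dist_norm by transfer simp
  have "Cauchy (\<lambda>n. blinfun_of_bop (X n))"
    using \<open>Cauchy X\<close> by (simp add: Cauchy_def dist)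
  then obtain f where f: "(\<lambda>n. blinfun_of_bop (X n)) \<longlonglongrightarrow> f"
    by (auto simp: Cauchy_convergent_iff convergent_def)
  have lim: "(\<lambda>n. blinfun_apply (blinfun_of_bop (X n)) x) \<longlonglongrightarrow> blinfun_apply f x" for x
    by (intro tendsto_intros f)
  have "blinfun_apply f (c *\<^sub>C x) = c *\<^sub>C blinfun_apply f x" for c x
  proof (rule LIMSEQ_unique)
    show "(\<lambda>n. blinfun_apply (blinfun_of_bop (X n)) (c *\<^sub>C x)) \<longlonglongrightarrow> blinfun_apply f (c *\<^sub>C x)"
      by (rule lim)
    show "(\<lambda>n. blinfun_apply (blinfun_of_bop (X n)) (c *\<^sub>C x)) \<longlonglongrightarrow> c *\<^sub>C blinfun_apply f x"
      using bounded_linear.tendsto[OF bounded_linear_scaleC lim]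
      by (simp add: bop_apply_scaleC_arg flip: bop_apply.rep_eq)
  qed
  then have "blinfun_of_bop (Bop f) = f"
    by (simp add: Bop_inverse)
  then have "X \<longlonglongrightarrow> Bop f"
    using f by (simp add: tendsto_iff flip: dist)
  then show "convergent X"
    by (auto simp: convergent_def)
qed


section \<open>Multiplication operators\<close>

definition lmult :: "'a::complex_normed_vector bop \<Rightarrow> 'a bop bop"
  where "lmult T = Bop (Blinfun (\<lambda>S. T * S))"

definition rmult :: "'a::complex_normed_vector bop \<Rightarrow> 'a bop bop"
  where "rmult T = Bop (Blinfun (\<lambda>S. S * T))"

lemma scaleC_times_left: "(c *\<^sub>C S) * T = c *\<^sub>C (S * T)" for S T :: "'a::complex_normed_vector bop"
  by (rule bop_eqI) (simp add: bop_apply_times bop_apply_scaleC)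

lemma scaleC_times_right: "T * (c *\<^sub>C S) = c *\<^sub>C (T * S)" for S T :: "'a::complex_normed_vector bop"
  by (rule bop_eqI) (simp add: bop_apply_times bop_apply_scaleC bop_apply_scaleC_arg)

text \<open>The abstraction functions \<open>Bop\<close> and \<open>Blinfun\<close> are applied inside their domains:\<close>

lemma bop_apply_lmult: "bop_apply (lmult T) S = T * S"
  by (simp add: lmult_def bop_apply.rep_eq Bop_inverse bounded_linear_Blinfun_apply
      bounded_linear_mult_right scaleC_times_right)

lemma bop_apply_rmult: "bop_apply (rmult T) S = S * T"
  by (simp add: rmult_def bop_apply.rep_eq Bop_inverse bounded_linear_Blinfun_apply
      bounded_linear_mult_left scaleC_times_left)


section \<open>Spectrum, poles of the resolvent, and Drazin invertibility\<close>

definition is_inverse :: "'a::complex_normed_vector bop \<Rightarrow> 'a bop \<Rightarrow> bool"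
  where "is_inverse U V \<longleftrightarrow> U * V = 1 \<and> V * U = 1"

definition spectrum :: "'a::complex_normed_vector bop \<Rightarrow> complex set"
  where "spectrum U = {\<mu>. \<not> (\<exists>V. is_inverse (U - \<mu> *\<^sub>C 1) V)}"

text \<open>Only meaningful outside the spectrum, where the inverse exists and is unique.\<close>

definition resolvent :: "'a::complex_normed_vector bop \<Rightarrow> complex \<Rightarrow> 'a bop"
  where "resolvent U \<mu> = (THE V. is_inverse (U - \<mu> *\<^sub>C 1) V)"

text \<open>
  A function \<open>f\<close> with values in a Banach space has a pole at \<open>a\<close> if, on some punctured disc around
  \<open>a\<close>, it has a Laurent expansion with finite but nonempty principal part,
  \<open>f z = (\<Sum>k. (z - a)^(k - n) c\<^sub>k)\<close> with \<open>n > 0\<close> and \<open>c\<^sub>0 \<noteq> 0\<close>.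
  The library predicate \<open>is_pole\<close> (that is, \<open>f z \<rightarrow> \<infinity>\<close> as \<open>z \<rightarrow> a\<close>) is not the right notion here:
  the norm of a vector-valued function may tend to infinity at an essential singularity, and that
  of a resolvent does so at every isolated point of the spectrum.
\<close>

definition has_pole :: "(complex \<Rightarrow> 'a::complex_normed_vector) \<Rightarrow> complex \<Rightarrow> bool"
  where "has_pole f a \<longleftrightarrow>
    (\<exists>n>0. \<exists>r>0. \<exists>c :: nat \<Rightarrow> 'a. c 0 \<noteq> 0 \<and>
      (\<forall>z \<in> ball a r - {a}. (\<lambda>k. (z - a) powi (int k - int n) *\<^sub>C c k) sums f z))"

definition resolvent_poles :: "'a::complex_normed_vector bop \<Rightarrow> complex set"
  where "resolvent_poles U = {\<mu>. \<mu> isolated_in spectrum U \<and> has_pole (resolvent U) \<mu>}"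

definition meromorphic_op :: "'a::complex_normed_vector bop \<Rightarrow> bool"
  where "meromorphic_op U \<longleftrightarrow> spectrum U - {0} \<subseteq> resolvent_poles U"

definition drazin_invertible :: "'a::complex_normed_vector bop \<Rightarrow> bool"
  where "drazin_invertible U \<longleftrightarrow>
    (\<exists>V. \<exists>m::nat. U ^ m * V * U = U ^ m \<and> V * U * V = V \<and> U * V = V * U)"

definition drazin_spectrum :: "'a::complex_normed_vector bop \<Rightarrow> complex set"
  where "drazin_spectrum U = {\<mu>. \<not> drazin_invertible (U - \<mu> *\<^sub>C 1)}"

definition finite_dim_range :: "'a::complex_normed_vector bop \<Rightarrow> bool"
  where "finite_dim_range U \<longleftrightarrow> (\<exists>B. finite B \<and> range (bop_apply U) = complex.span B)"

end

theory Submission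
  imports Defs
begin

text \<open>
  Everything rests on one local equivalence (\<open>drazin_invertible_iff_regular_or_pole\<close>):
  \<open>U - \<mu>\<close> is Drazin invertible exactly if \<open>\<mu>\<close> lies outside the spectrum or is a pole of the
  resolvent. Hence \<open>U\<close> is meromorphic iff \<open>U - \<mu>\<close> is Drazin invertible for every \<open>\<mu> \<noteq> 0\<close>, and
  all three parts of the theorem become statements about Drazin invertibility.

  For the equivalence, put \<open>A = U - \<mu>\<close>. If \<open>V\<close> is a Drazin inverse of \<open>A\<close>, then \<open>Q = 1 - A V\<close>
  splits \<open>A\<close> into an invertible and a nilpotent piece, and
  \<open>(A - z)\<^sup>-\<^sup>1 = (\<Sum>k. z\<^sup>k V\<^sup>k\<^sup>+\<^sup>1) - (\<Sum>j<n. z\<^sup>-\<^sup>j\<^sup>-\<^sup>1 A\<^sup>j Q)\<close> is the required Laurent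
  expansion. Conversely, comparing coefficients in \<open>(A - z) R(z) = 1\<close> for a Laurent expansion of
  the resolvent \<open>R\<close> with principal part of length \<open>n\<close> shows that its constant coefficient \<open>V\<close>
  commutes with \<open>A\<close> and satisfies \<open>A\<^sup>n (1 - A V) = 0\<close>. In general, elements with
  these two properties (weak inverses) are not unique and can differ from the Drazin inverse, but
  the existence of one already implies Drazin invertibility (\<open>drazin_invertibleI\<close>). This weak
  criterion is what makes the remaining arguments short. In the other direction, the
  Drazin inverse can be taken in the bicommutant (\<open>drazin_invertibleE\<close>).

  For the multiplication operators, a Drazin inverse \<open>W\<close> of \<open>L\<^sub>A\<close> commutes with \<open>L\<^sub>A\<close> and \<open>R\<^sub>A\<close>;
  evaluated at the identity these relations say that \<open>W(1)\<close> is a weak inverse of \<open>A\<close>. For products,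
  a weak inverse of \<open>ab - \<mu>\<close> is carried to one of \<open>ba - \<mu>\<close> by Jacobson's formula for
  the inverse of \<open>1 - ba\<close>.

  For the perturbation \<open>B = A + F\<close>, let \<open>v\<close> be the Drazin inverse of \<open>A\<close>. Modulo \<open>F\<close> it is a weak
  inverse of \<open>B\<close>, so that \<open>B\<^sup>m (1 - B v) = F s\<close>, and the \<open>n\<close>-th power of this element is a multiple
  of \<open>F\<^sup>n\<close>. The finite-dimensional range of \<open>F\<^sup>n\<close> is invariant under \<open>B\<close>, so some nonzero
  polynomial in \<open>B\<close> vanishes on it; written as \<open>B\<^sup>k (1 - B w)\<close> it kills \<open>F\<^sup>n\<close>. The product of the two
  elements is zero and has the form \<open>B\<^sup>M (1 - B u)\<close>, which is the weak criterion for \<open>B\<close>.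
\<close>

section \<open>Commuting elements\<close>

lemma bop_apply_simps [simp]:
  fixes f g :: "'a::complex_normed_vector bop"
  shows "bop_apply 1 x = x" "bop_apply 0 x = 0"
    "bop_apply (f + g) x = bop_apply f x + bop_apply g x"
    "bop_apply (f - g) x = bop_apply f x - bop_apply g x"
    "bop_apply f 0 = 0"
    "bop_apply f (x + y) = bop_apply f x + bop_apply f y"
    "bop_apply f (x - y) = bop_apply f x - bop_apply f y"
  by (transfer; simp add: blinfun.bilinear_simps)+

lemma power_mult_commuting:
  fixes x y :: "'a::monoid_mult"
  assumes "x * y = y * x"
  shows "(x * y) ^ n = x ^ n * y ^ n"
proof (induction n)
  case (Suc n)
  have "y * x ^ n = x ^ n * y"
    using power_commuting_commutes[OF assms] by simp
  then show ?case
    using Suc by (simp add: mult.assoc) (simp add: mult.assoc[symmetric])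
qed simp

lemma left_commute_of_commute:
  fixes x y z :: "'a::semigroup_mult"
  shows "x * y = y * x \<Longrightarrow> x * (y * z) = y * (x * z)"
  by (metis mult.assoc)

lemma is_inverse_unique: "is_inverse W V \<Longrightarrow> is_inverse W V' \<Longrightarrow> V = V'"
  unfolding is_inverse_def by (metis mult.assoc mult_1_left mult_1_right)

text \<open>
  The Drazin inverse of \<open>a\<close> and the polynomials in \<open>a\<close> all belong to the bicommutant of \<open>a\<close>, a
  commutative subring. It supplies commutation relations without any need to speak of polynomials
  in an operator.
\<close>
definition bicommutant :: "'a::semigroup_mult \<Rightarrow> 'a set"
  where "bicommutant a = {w. \<forall>s. s * a = a * s \<longrightarrow> s * w = w * s}"

lemma bicommutant_commute: "w \<in> bicommutant a \<Longrightarrow> s * a = a * s \<Longrightarrow> s * w = w * s"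
  by (simp add: bicommutant_def)

lemma bicommutant_self: "w \<in> bicommutant a \<Longrightarrow> a * w = w * a"
  by (simp add: bicommutant_def)

lemma bicommutant_closed:
  fixes a :: "'a::{ring, monoid_mult}"
  shows "a \<in> bicommutant a" "0 \<in> bicommutant a" "1 \<in> bicommutant a"
    "v \<in> bicommutant a \<Longrightarrow> w \<in> bicommutant a \<Longrightarrow> v + w \<in> bicommutant a"
    "v \<in> bicommutant a \<Longrightarrow> w \<in> bicommutant a \<Longrightarrow> v - w \<in> bicommutant a"
    "v \<in> bicommutant a \<Longrightarrow> w \<in> bicommutant a \<Longrightarrow> v * w \<in> bicommutant a"
    "v \<in> bicommutant a \<Longrightarrow> v ^ n \<in> bicommutant a"
proof -
  show mult: "v * w \<in> bicommutant a" if "v \<in> bicommutant a" "w \<in> bicommutant a" for v w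
    using that unfolding bicommutant_def by (smt (verit) mem_Collect_eq mult.assoc)
  show one: "1 \<in> bicommutant a"
    by (simp add: bicommutant_def)
  show "v ^ n \<in> bicommutant a" if "v \<in> bicommutant a"
    using that by (induction n) (simp_all add: one mult)
qed (simp_all add: bicommutant_def algebra_simps)

lemma bicommutant_scaleC:
  fixes a w :: "'a::complex_normed_vector bop"
  shows "w \<in> bicommutant a \<Longrightarrow> c *\<^sub>C w \<in> bicommutant a"
  by (simp add: bicommutant_def scaleC_times_left scaleC_times_right)

section \<open>A weak criterion for Drazin invertibility\<close>

text \<open>
  The relation on \<open>V\<close> lets \<open>U ^ m\<close> absorb any power of \<open>U * V\<close>. Therefore
  \<open>U ^ m * V ^ Suc m\<close>, which is \<open>V\<close> cut down to the part where \<open>U\<close> is invertible, satisfies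
  all three Drazin equations.
\<close>
lemma drazin_invertibleI:
  fixes U :: "'a::complex_normed_vector bop"
  assumes comm: "U * V = V * U" and pow: "U ^ m * (1 - U * V) = 0"
  shows "drazin_invertible U"
proof -
  define W where "W = U ^ m * V ^ Suc m"
  have e: "U ^ m * (U * V) = U ^ m"
    using pow by (simp add: right_diff_distrib)
  have absorb: "U ^ m * (U * V) ^ k = U ^ m" for k
  proof (induction k)
    case (Suc k)
    have "U ^ m * (U * V) ^ Suc k = U ^ m * (U * V) * (U * V) ^ k"
      by (simp add: mult.assoc)
    with e Suc show ?case by simp
  qed simp
  have VU: "V ^ j * U = U * V ^ j" for j
    by (rule power_commuting_commutes) (simp add: comm)
  have VU': "V ^ j * U ^ i = U ^ i * V ^ j" for i j
    using power_commuting_commutes[OF VU[of j, symmetric], of i] by simp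
  have UW: "U * W = (U * V) ^ Suc m"
    by (simp only: power_mult_commuting[OF comm]) (simp add: W_def mult.assoc)
  have WU: "W * U = U * W"
    unfolding W_def by (simp only: mult.assoc VU) (simp only: mult.assoc[symmetric] power_commutes)
  have "U ^ m * W * U = U ^ m"
    using absorb by (simp only: mult.assoc WU UW)
  moreover have "W * U * W = W"
  proof -
    have "W * U * W = U * W * W" by (simp only: WU)
    also have "\<dots> = W * (U * W)" by (simp only: WU[symmetric] mult.assoc)
    also have "\<dots> = U ^ m * (V ^ Suc m * (U ^ Suc m * V ^ Suc m))"
      by (simp only: UW power_mult_commuting[OF comm]) (simp only: W_def mult.assoc)
    also have "\<dots> = U ^ m * (U ^ Suc m * V ^ Suc m) * V ^ Suc m"
      by (simp only: mult.assoc left_commute_of_commute[OF VU'])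
    also have "\<dots> = W"
      by (simp only: power_mult_commuting[OF comm, symmetric] absorb) (simp only: W_def)
    finally show ?thesis .
  qed
  ultimately show ?thesis
    using WU unfolding drazin_invertible_def by metis
qed

text \<open>
  The Drazin inverse commutes with everything that commutes with \<open>U\<close>. The idempotent \<open>p = U * V\<close>
  equals \<open>U ^ Suc m * V ^ Suc m\<close>, so it is a multiple of \<open>U ^ Suc m\<close> on either side, while
  \<open>U ^ Suc m\<close> annihilates \<open>1 - p\<close>. Moving \<open>U ^ Suc m\<close> past \<open>s\<close> therefore kills both off-diagonal
  corners of \<open>s\<close>, so \<open>s\<close> commutes with \<open>p\<close>, and then with \<open>V\<close>.
\<close>
lemma drazin_invertibleE:
  fixes U :: "'a::complex_normed_vector bop"
  assumes "drazin_invertible U"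
  obtains V m where "V \<in> bicommutant U" "V * U * V = V" "U ^ m * (1 - U * V) = 0"
proof -
  obtain V m where pow: "U ^ m * V * U = U ^ m" and VUV: "V * U * V = V" and comm: "U * V = V * U"
    using assms unfolding drazin_invertible_def by blast
  define p where "p = U * V"
  have pow': "U ^ m * (1 - p) = 0"
    using pow comm by (simp add: p_def right_diff_distrib mult.assoc)
  have idem: "p * p = p"
    using VUV by (simp add: p_def mult.assoc)
  have "p ^ Suc k = p" for k
    by (induction k) (use idem in auto)
  then have p: "p = U ^ Suc m * V ^ Suc m"
    using power_mult_commuting[OF comm, of "Suc m"] unfolding p_def by metis
  have "(V * U) ^ Suc m = V ^ Suc m * U ^ Suc m"
    by (rule power_mult_commuting) (simp add: comm)
  then have p': "p = V ^ Suc m * U ^ Suc m"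
    using \<open>\<And>k. p ^ Suc k = p\<close> unfolding p_def comm by metis
  have z: "U ^ Suc m * (1 - p) = 0"
    by (simp add: mult.assoc pow')
  have Up: "U * p = p * U"
    by (simp add: p_def mult.assoc flip: comm)
  have "U ^ Suc m * p = p * U ^ Suc m"
    by (rule power_commuting_commutes) (rule Up)
  then have z': "(1 - p) * U ^ Suc m = 0"
    using z by (simp only: left_diff_distrib right_diff_distrib mult_1_left mult_1_right)
  have "s * V = V * s" if s: "s * U = U * s" for s
  proof -
    have sU: "U ^ Suc m * s = s * U ^ Suc m"
      by (rule power_commuting_commutes) (simp add: s)
    have "p * s * (1 - p) = V ^ Suc m * s * (U ^ Suc m * (1 - p))"
      by (subst p') (simp only: mult.assoc sU left_commute_of_commute[OF sU])
    then have 1: "p * s = p * s * p"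
      using z by (simp add: right_diff_distrib)
    have "(1 - p) * s * p = (1 - p) * U ^ Suc m * (s * V ^ Suc m)"
      by (subst (2) p) (simp only: mult.assoc sU left_commute_of_commute[OF sU])
    then have 2: "s * p = p * s * p"
      using z' by (simp add: left_diff_distrib)
    have ps: "p * s = s * p" using 1 2 by simp
    have pV: "p * V = V" "V * p = V"
      using VUV comm by (simp_all add: p_def mult.assoc)
    have "V * s = V * (p * s)"
      by (simp only: mult.assoc[symmetric] pV)
    also have "\<dots> = V * (s * (U * V))"
      by (simp only: ps) (simp only: p_def)
    also have "\<dots> = V * (U * (s * V))"
      by (simp only: left_commute_of_commute[OF s])
    also have "\<dots> = p * s * V"
      by (simp only: p_def comm mult.assoc)
    also have "\<dots> = s * V"
      by (simp only: ps mult.assoc pV)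
    finally show ?thesis by simp
  qed
  then have "V \<in> bicommutant U"
    by (auto simp: bicommutant_def)
  with that VUV pow' show thesis
    by (auto simp: p_def)
qed


section \<open>Power series with vector coefficients\<close>

text \<open>
  Convergence at one radius \<open>\<rho>\<close> bounds \<open>\<rho> ^ k * norm (d k)\<close> by a constant \<open>M\<close>. At the
  point \<open>t * \<rho>\<close> the terms after the first are then dominated by a geometric series with sum
  \<open>M * (t / (1 - t))\<close>, which tends to 0 with \<open>t\<close>.
\<close>
lemma vector_powser_zero_const:
  fixes d :: "nat \<Rightarrow> 'a::cbanach"
  assumes "r > 0" and zero: "\<And>z. z \<in> ball 0 r - {0} \<Longrightarrow> (\<lambda>k. z ^ k *\<^sub>C d k) sums 0"
  shows "d 0 = 0"
proof (rule ccontr)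
  assume d0: "d 0 \<noteq> 0"
  define \<rho> where "\<rho> = r / 2"
  have \<rho>: "0 < \<rho>" "\<rho> < r" using \<open>r > 0\<close> by (simp_all add: \<rho>_def)
  have "(\<lambda>k. complex_of_real \<rho> ^ k *\<^sub>C d k) sums 0"
    by (rule zero) (use \<rho> in auto)
  then have "(\<lambda>k. complex_of_real \<rho> ^ k *\<^sub>C d k) \<longlonglongrightarrow> 0"
    by (intro summable_LIMSEQ_zero) (rule sums_summable)
  then have "Bseq (\<lambda>k. complex_of_real \<rho> ^ k *\<^sub>C d k)"
    by (intro convergent_imp_Bseq) (auto simp: convergent_def)
  then obtain M where M: "M > 0" "\<And>k. norm (complex_of_real \<rho> ^ k *\<^sub>C d k) \<le> M"
    by (auto simp: Bseq_def)
  have bound: "\<rho> ^ k * norm (d k) \<le> M" for k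
    using M(2)[of k] \<rho> by (simp add: norm_scaleC norm_power)
  have est: "norm (d 0) \<le> M * (t / (1 - t))" if t: "0 < t" "t < 1" for t
  proof -
    have "(\<lambda>k. complex_of_real (t * \<rho>) ^ k *\<^sub>C d k) sums 0"
    proof (rule zero)
      have "t * \<rho> < r" using t \<rho> by (smt (verit) mult_less_cancel_right2)
      then show "complex_of_real (t * \<rho>) \<in> ball 0 r - {0}"
        using t \<rho> by (simp add: abs_mult del: of_real_mult)
    qed
    then have "(\<lambda>k. complex_of_real (t * \<rho>) ^ Suc k *\<^sub>C d (Suc k)) sums (- d 0)"
      by (subst sums_Suc_iff) simp
    moreover have "(\<lambda>k. M * (t * t ^ k)) sums (M * (t * (1 / (1 - t))))"
      using t by (intro sums_mult geometric_sums) auto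
    moreover have "norm (complex_of_real (t * \<rho>) ^ Suc k *\<^sub>C d (Suc k)) \<le> M * (t * t ^ k)" for k
    proof -
      have "norm (complex_of_real (t * \<rho>) ^ Suc k *\<^sub>C d (Suc k)) = t ^ Suc k * (\<rho> ^ Suc k * norm (d (Suc k)))"
        using t \<rho> by (simp add: norm_scaleC norm_power norm_mult power_mult_distrib del: of_real_mult power_Suc)
      also have "\<dots> \<le> t ^ Suc k * M"
        using t bound[of "Suc k"] by (intro mult_left_mono) auto
      finally show ?thesis by (simp add: mult_ac)
    qed
    ultimately have "norm (- d 0) \<le> M * (t * (1 / (1 - t)))"
      by (rule norm_sums_le)
    then show ?thesis by simp
  qed
  have "((\<lambda>t. M * (t / (1 - t))) \<longlongrightarrow> M * (0 / (1 - 0))) (at_right 0)"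
    by (intro tendsto_intros) auto
  then have "((\<lambda>t. M * (t / (1 - t))) \<longlongrightarrow> 0) (at_right 0)" by simp
  moreover have "\<forall>\<^sub>F t in at_right (0::real). norm (d 0) \<le> M * (t / (1 - t))"
    using eventually_at_right_real[of 0 1] by (rule eventually_mono) (use est in auto)
  ultimately have "norm (d 0) \<le> 0"
    by (rule tendsto_lowerbound) simp
  with d0 show False by simp
qed

lemma vector_powser_zero:
  fixes d :: "nat \<Rightarrow> 'a::cbanach"
  assumes "r > 0" and "\<And>z. z \<in> ball 0 r - {0} \<Longrightarrow> (\<lambda>k. z ^ k *\<^sub>C d k) sums 0"
  shows "d k = 0"
  using assms(2)
proof (induction k arbitrary: d)
  case 0
  then show ?case using vector_powser_zero_const[OF \<open>r > 0\<close>] by blast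
next
  case (Suc k)
  have d0: "d 0 = 0"
    using vector_powser_zero_const[OF \<open>r > 0\<close>] Suc.prems by blast
  have "(\<lambda>k. z ^ k *\<^sub>C d (Suc k)) sums 0" if z: "z \<in> ball 0 r - {0}" for z
  proof -
    have "(\<lambda>k. z ^ Suc k *\<^sub>C d (Suc k)) sums 0"
      using Suc.prems[OF z] by (subst sums_Suc_iff) (simp add: d0)
    from bounded_linear.sums[OF bounded_linear_scaleC this, of "inverse z"]
    show ?thesis using z by (simp add: scaleC_scaleC flip: mult.assoc)
  qed
  from Suc.IH[of "\<lambda>k. d (Suc k)", OF this] show ?case .
qed

section \<open>Poles of the resolvent\<close>

lemma commute_diff_scaleC_one:
  fixes s U :: "'a::complex_normed_vector bop"
  shows "s * U = U * s \<Longrightarrow> s * (U - \<mu> *\<^sub>C 1) = (U - \<mu> *\<^sub>C 1) * s"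
  by (simp add: algebra_simps scaleC_times_left scaleC_times_right)

lemma power_mult_powi_diff:
  fixes z :: complex
  shows "z \<noteq> 0 \<Longrightarrow> z ^ n * z powi (int k - int n) = z ^ k"
  by (simp add: power_int_diff)

text \<open>
  Let \<open>c\<close> be the coefficients of the Laurent series, with \<open>c n\<close> the constant one. Since the resolvent
  commutes with \<open>A\<close>, so does every coefficient. Comparing coefficients in \<open>(A - z) R(z) = 1\<close>
  yields \<open>A (c k) = c (k - 1)\<close> for \<open>k \<noteq> n\<close>, with an additional summand 1 for \<open>k = n\<close>. Thus
  \<open>1 - A (c n) = - c (n - 1)\<close>, and iterating the recursion down to \<open>A (c 0) = 0\<close> shows that
  \<open>A ^ n\<close> annihilates \<open>c (n - 1)\<close>.
\<close>
lemma drazin_invertible_if_pole: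
  fixes U :: "'a::cbanach bop"
  assumes "\<mu> \<in> resolvent_poles U"
  shows "drazin_invertible (U - \<mu> *\<^sub>C 1)"
proof -
  define A where "A = U - \<mu> *\<^sub>C 1"
  obtain n r and c :: "nat \<Rightarrow> 'a bop" where n: "n > 0" and r: "r > 0"
    and c: "\<And>z. z \<in> ball \<mu> r - {\<mu>} \<Longrightarrow> (\<lambda>k. (z - \<mu>) powi (int k - int n) *\<^sub>C c k) sums resolvent U z"
    using assms unfolding resolvent_poles_def has_pole_def by blast
  obtain O' where O': "open O'" "O' \<inter> spectrum U = {\<mu>}"
    using assms unfolding resolvent_poles_def isolated_in_def by blast
  obtain \<epsilon> where \<epsilon>: "\<epsilon> > 0" "ball \<mu> \<epsilon> \<subseteq> O'"
    using O' by (metis Int_iff insertI1 openE)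
  define \<rho> where "\<rho> = min r \<epsilon>"
  have \<rho>: "\<rho> > 0" using r \<epsilon> by (simp add: \<rho>_def)
  define R where "R z = resolvent U (\<mu> + z)" for z
  have R: "is_inverse (A - z *\<^sub>C 1) (R z)"
    and ser: "(\<lambda>k. z ^ k *\<^sub>C c k) sums (z ^ n *\<^sub>C R z)" if z: "z \<in> ball 0 \<rho> - {0}" for z
  proof -
    have "\<mu> + z \<in> ball \<mu> \<epsilon> - {\<mu>}" using z by (simp add: \<rho>_def dist_norm)
    then have "\<mu> + z \<notin> spectrum U" using O' \<epsilon> by blast
    then obtain V where V: "is_inverse (U - (\<mu> + z) *\<^sub>C 1) V"
      unfolding spectrum_def by blast
    have "R z = V"
      unfolding R_def resolvent_def using V is_inverse_unique by blast
    then show "is_inverse (A - z *\<^sub>C 1) (R z)"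
      using V by (simp add: A_def scaleC_add_left algebra_simps)
    have "\<mu> + z \<in> ball \<mu> r - {\<mu>}" using z by (simp add: \<rho>_def dist_norm)
    from bounded_linear.sums[OF bounded_linear_scaleC c[OF this], of "z ^ n"]
    show "(\<lambda>k. z ^ k *\<^sub>C c k) sums (z ^ n *\<^sub>C R z)"
      using z by (simp add: power_mult_powi_diff R_def)
  qed
  \<comment> \<open>the coefficients of \<open>z R(z)\<close>, for comparison with those of \<open>A R(z)\<close>\<close>
  define c' where "c' k = (case k of 0 \<Rightarrow> 0 | Suc j \<Rightarrow> c j)" for k
  have "A * c k - c k * A = 0" for k
  proof (rule vector_powser_zero[OF \<rho>])
    fix z :: complex assume z: "z \<in> ball 0 \<rho> - {0}"
    have "A * R z = R z * A"
    proof -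
      have "A * R z = (A - z *\<^sub>C 1) * R z + z *\<^sub>C R z"
        by (simp add: left_diff_distrib scaleC_times_left)
      also have "\<dots> = R z * (A - z *\<^sub>C 1) + z *\<^sub>C R z"
        using R[OF z] by (simp add: is_inverse_def)
      also have "\<dots> = R z * A"
        by (simp add: right_diff_distrib scaleC_times_right)
      finally show ?thesis .
    qed
    moreover have "(\<lambda>k. A * z ^ k *\<^sub>C c k - z ^ k *\<^sub>C c k * A) sums
        (A * z ^ n *\<^sub>C R z - z ^ n *\<^sub>C R z * A)"
      using ser[OF z]
      by (intro sums_diff bounded_linear.sums[OF bounded_linear_mult_left]
          bounded_linear.sums[OF bounded_linear_mult_right])
    ultimately show "(\<lambda>k. z ^ k *\<^sub>C (A * c k - c k * A)) sums 0"
      by (simp add: scaleC_times_left scaleC_times_right complex.scale_right_diff_distrib)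
  qed
  then have comm: "A * c k = c k * A" for k by simp
  have "A * c k - c' k - (if k = n then 1 else 0) = 0" for k
  proof (rule vector_powser_zero[OF \<rho>, where k = k])
    fix z :: complex assume z: "z \<in> ball 0 \<rho> - {0}"
    have 1: "(\<lambda>k. A * z ^ k *\<^sub>C c k) sums (A * z ^ n *\<^sub>C R z)"
      by (rule bounded_linear.sums[OF bounded_linear_mult_right ser[OF z]])
    have "(\<lambda>k. z ^ Suc k *\<^sub>C c' (Suc k)) sums (z *\<^sub>C z ^ n *\<^sub>C R z)"
      using bounded_linear.sums[OF bounded_linear_scaleC ser[OF z], of z]
      by (simp add: c'_def scaleC_scaleC)
    then have 2: "(\<lambda>k. z ^ k *\<^sub>C c' k) sums (z *\<^sub>C z ^ n *\<^sub>C R z)"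
      by (subst (asm) sums_Suc_iff) (simp add: c'_def)
    have 3: "(\<lambda>k. if k = n then z ^ k *\<^sub>C 1 else 0) sums (z ^ n *\<^sub>C (1 :: 'a bop))"
      using sums_single[of n "\<lambda>k. z ^ k *\<^sub>C (1 :: 'a bop)"] .
    have "A * z ^ n *\<^sub>C R z - z *\<^sub>C z ^ n *\<^sub>C R z - z ^ n *\<^sub>C 1
        = z ^ n *\<^sub>C ((A - z *\<^sub>C 1) * R z - 1)"
      by (simp add: algebra_simps complex.scale_right_diff_distrib scaleC_times_left
          scaleC_times_right scaleC_scaleC)
    also have "\<dots> = 0"
      using R[OF z] by (simp add: is_inverse_def)
    finally have "(\<lambda>k. A * z ^ k *\<^sub>C c k - z ^ k *\<^sub>C c' k - (if k = n then z ^ k *\<^sub>C 1 else 0)) sums 0"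
      using sums_diff[OF sums_diff[OF 1 2] 3] by simp
    moreover have "A * z ^ k *\<^sub>C c k - z ^ k *\<^sub>C c' k - (if k = n then z ^ k *\<^sub>C 1 else 0)
      = z ^ k *\<^sub>C (A * c k - c' k - (if k = n then 1 else 0))" for k
      by (simp add: scaleC_times_right complex.scale_right_diff_distrib)
    ultimately show "(\<lambda>k. z ^ k *\<^sub>C (A * c k - c' k - (if k = n then 1 else 0))) sums 0"
      by simp
  qed
  then have rec: "A * c k = c' k + (if k = n then 1 else 0)" for k
    by (simp add: algebra_simps)
  have kill: "A ^ Suc k * c k = 0" if "k < n" for k
    using that
  proof (induction k)
    case 0
    then show ?case using rec[of 0] by (simp add: c'_def)
  next
    case (Suc k)
    have "A ^ Suc (Suc k) * c (Suc k) = A ^ Suc k * (A * c (Suc k))"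
      by (simp only: power_Suc2 mult.assoc)
    also have "A * c (Suc k) = c k"
      using rec[of "Suc k"] Suc.prems by (simp add: c'_def)
    finally show ?case using Suc by simp
  qed
  obtain j where j: "n = Suc j" using n by (cases n) auto
  have "1 - A * c n = - c j"
    using rec[of n] by (simp add: c'_def j)
  then have "A ^ n * (1 - A * c n) = 0"
    using kill[of j] by (simp add: j)
  with comm show ?thesis
    unfolding A_def[symmetric] by (rule drazin_invertibleI)
qed

text \<open>Only positive exponents: on the zero space, the norm of \<open>x ^ 0\<close> is 0 and not 1, and in a general
  normed algebra with a unit it may exceed 1.\<close>
lemma norm_power_Suc_le:
  fixes x :: "'a::{real_normed_algebra, monoid_mult}"
  shows "norm (x ^ Suc n) \<le> norm x ^ Suc n"
proof (induction n)
  case (Suc n)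
  have "norm (x ^ Suc (Suc n)) \<le> norm x * norm (x ^ Suc n)"
    unfolding power_Suc[of x "Suc n"] by (rule norm_mult_ineq)
  also have "\<dots> \<le> norm x * norm x ^ Suc n"
    by (rule mult_left_mono[OF Suc norm_ge_zero])
  finally show ?case by simp
qed simp

text \<open>
  The explicit Laurent expansion. Both the regular part \<open>G\<close> and the principal part are telescoping
  sums after multiplication by \<open>A - z\<close>: the former gives the idempotent \<open>A * V\<close>, the latter the
  complementary one, where the boundary term vanishes since \<open>A ^ n * (1 - A * V) = 0\<close>. The series
  converges for \<open>cmod z * norm V < 1\<close> like a geometric one.
\<close>
lemma drazin_resolvent_laurent:
  fixes A V :: "'a::cbanach bop"
  assumes comm: "A * V = V * A" and VAV: "V * A * V = V" and pow: "A ^ n * (1 - A * V) = 0"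
    and z: "z \<noteq> 0" "cmod z * norm V < 1"
  defines "c \<equiv> \<lambda>k. if k < n then - (A ^ (n - Suc k) * (1 - A * V)) else V ^ Suc (k - n)"
  shows "\<exists>W. (\<lambda>k. z powi (int k - int n) *\<^sub>C c k) sums W \<and> is_inverse (A - z *\<^sub>C 1) W"
proof -
  define f where "f = (\<lambda>k. z powi (int k - int n) *\<^sub>C c k)"
  define g where "g = (\<lambda>i. z powi (int i - int n) *\<^sub>C (A ^ (n - i) * (1 - A * V)))"
  define u where "u = (\<lambda>k. z ^ k *\<^sub>C (A * V ^ Suc k))"
  have regular_part: "f (k + n) = z ^ k *\<^sub>C V ^ Suc k" for k
    by (simp add: f_def c_def)
  have "summable (\<lambda>k. z ^ k *\<^sub>C V ^ Suc k)"
  proof (rule summable_comparison_test')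
    show "summable (\<lambda>k. norm V * (cmod z * norm V) ^ k)"
      using z by (intro summable_mult summable_geometric) simp
    show "norm (z ^ k *\<^sub>C V ^ Suc k) \<le> norm V * (cmod z * norm V) ^ k" for k
      using mult_left_mono[OF norm_power_Suc_le[of V k], of "cmod z ^ k"]
      by (simp add: norm_scaleC norm_power power_mult_distrib mult_ac)
  qed
  then obtain G where G: "(\<lambda>k. z ^ k *\<^sub>C V ^ Suc k) sums G"
    by (auto simp: summable_def)
  have AVV: "A * V ^ Suc (Suc k) = V ^ Suc k" for k
  proof -
    have "A * V * V = V" using VAV comm by (simp add: mult.assoc)
    then show ?thesis by (simp add: mult.assoc[symmetric])
  qed
  have "u \<longlonglongrightarrow> 0"
    using summable_LIMSEQ_zero[OF sums_summable[OF bounded_linear.sums[OF bounded_linear_mult_right G]], of A]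
    by (simp add: u_def scaleC_times_right)
  then have "(\<lambda>k. u k - u (Suc k)) sums (A * V)"
    using telescope_sums'[of u 0] by (simp add: u_def)
  moreover have "(A - z *\<^sub>C 1) * (z ^ k *\<^sub>C V ^ Suc k) = u k - u (Suc k)" for k
    unfolding u_def AVV
    by (simp add: left_diff_distrib scaleC_times_left scaleC_times_right scaleC_scaleC mult.commute
        complex.scale_right_diff_distrib)
  ultimately have G1: "(A - z *\<^sub>C 1) * G = A * V"
    using bounded_linear.sums[OF bounded_linear_mult_right G, of "A - z *\<^sub>C 1"]
    by (simp add: sums_unique2)
  have "(A - z *\<^sub>C 1) * f i = g (Suc i) - g i" if "i < n" for i
  proof -
    define j where "j = n - Suc i"
    have j: "n - i = Suc j" using that by (simp add: j_def)
    have pw: "z * z powi (int i - int n) = z powi (int (Suc i) - int n)"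
      using z power_int_add[of z 1 "int i - int n"] by (simp add: algebra_simps)
    have expand: "(A - z *\<^sub>C 1) * (p *\<^sub>C - X) = (z * p) *\<^sub>C X - p *\<^sub>C (A * X)" for p X
      by (simp add: left_diff_distrib scaleC_times_left scaleC_times_right
          complex.scale_right_diff_distrib mult.commute)
    have "f i = z powi (int i - int n) *\<^sub>C - (A ^ j * (1 - A * V))"
      using that by (simp add: f_def c_def j_def)
    then show ?thesis
      by (simp only: expand pw) (simp only: g_def j power_Suc mult.assoc flip: j_def)
  qed
  then have "(A - z *\<^sub>C 1) * (\<Sum>i<n. f i) = (\<Sum>i<n. g (Suc i) - g i)"
    by (simp add: sum_distrib_left)
  also have "\<dots> = g n - g 0"
    by (rule sum_lessThan_telescope)
  also have "\<dots> = 1 - A * V"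
    by (simp add: g_def pow)
  finally have F1: "(A - z *\<^sub>C 1) * (\<Sum>i<n. f i) = 1 - A * V" .
  define W where "W = G + (\<Sum>i<n. f i)"
  have W: "f sums W"
    unfolding W_def sums_iff_shift[of f n, symmetric] regular_part by (rule G)
  have inv: "(A - z *\<^sub>C 1) * W = 1"
    using G1 F1 by (simp add: W_def distrib_left)
  have "A * c k = c k * A" for k
  proof -
    have V: "V ^ i * A = A * V ^ i" for i
      by (rule power_commuting_commutes) (simp add: comm)
    have q: "(1 - A * V) * A = A * (1 - A * V)"
      by (simp add: left_diff_distrib right_diff_distrib mult.assoc flip: comm)
    have "A ^ i * (1 - A * V) * A = A * (A ^ i * (1 - A * V))" for i
      by (simp only: mult.assoc q) (simp only: mult.assoc[symmetric] power_commutes)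
    with V show ?thesis
      by (simp add: c_def del: power_Suc)
  qed
  then have "A * f k = f k * A" for k
    by (simp add: f_def scaleC_times_left scaleC_times_right)
  then have "A * W = W * A"
    using bounded_linear.sums[OF bounded_linear_mult_right W, of A]
      bounded_linear.sums[OF bounded_linear_mult_left W, of A]
    by (simp add: sums_unique2)
  then have "W * (A - z *\<^sub>C 1) = 1"
    using inv commute_diff_scaleC_one[of W A z] by simp
  with W inv show ?thesis
    unfolding is_inverse_def f_def by blast
qed


text \<open>
  A pole requires a nonzero leading coefficient, so the expansion is used with the least \<open>n\<close> for
  which \<open>A ^ n\<close> annihilates \<open>1 - A * V\<close>. That \<open>n\<close> is positive because \<open>n = 0\<close> would make \<open>A\<close>
  invertible.
\<close>
lemma resolvent_pole_if_drazin_invertible: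
  fixes U :: "'a::cbanach bop"
  assumes "drazin_invertible (U - \<mu> *\<^sub>C 1)" and spec: "\<mu> \<in> spectrum U"
  shows "\<mu> \<in> resolvent_poles U"
proof -
  define A where "A = U - \<mu> *\<^sub>C 1"
  obtain V m where V: "V \<in> bicommutant A" and VAV: "V * A * V = V" and m: "A ^ m * (1 - A * V) = 0"
    using assms(1) unfolding A_def[symmetric] by (rule drazin_invertibleE)
  have comm: "A * V = V * A" using V by (rule bicommutant_self)
  define n where "n = (LEAST n. A ^ n * (1 - A * V) = 0)"
  have n: "A ^ n * (1 - A * V) = 0"
    unfolding n_def using m by (rule LeastI)
  have least: "A ^ k * (1 - A * V) \<noteq> 0" if "k < n" for k
    using that not_less_Least unfolding n_def by blast
  have "n > 0"
  proof (rule ccontr)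
    assume "\<not> n > 0"
    then have "is_inverse A V" using n comm by (simp add: is_inverse_def)
    then show False using spec unfolding spectrum_def A_def by blast
  qed
  define c where "c = (\<lambda>k. if k < n then - (A ^ (n - Suc k) * (1 - A * V)) else V ^ Suc (k - n))"
  have c0: "c 0 \<noteq> 0"
    using \<open>n > 0\<close> least[of "n - 1"] by (simp add: c_def)
  define r where "r = 1 / (1 + norm V)"
  have nV: "1 + norm V > 0" by (simp add: add_pos_nonneg)
  then have "r > 0" by (simp add: r_def)
  have laurent: "(\<lambda>k. (w - \<mu>) powi (int k - int n) *\<^sub>C c k) sums resolvent U w"
    and regular: "w \<notin> spectrum U" if w: "w \<in> ball \<mu> r - {\<mu>}" for w
  proof -
    have "cmod (w - \<mu>) < r" using w by (simp add: dist_norm norm_minus_commute)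
    then have "cmod (w - \<mu>) * (1 + norm V) < 1"
      using nV by (simp add: r_def pos_less_divide_eq)
    moreover have "cmod (w - \<mu>) * norm V \<le> cmod (w - \<mu>) * (1 + norm V)"
      by (intro mult_left_mono) auto
    ultimately have "cmod (w - \<mu>) * norm V < 1" by linarith
    moreover have "w - \<mu> \<noteq> 0" using w by simp
    ultimately obtain W where W: "(\<lambda>k. (w - \<mu>) powi (int k - int n) *\<^sub>C c k) sums W"
      "is_inverse (A - (w - \<mu>) *\<^sub>C 1) W"
      using drazin_resolvent_laurent[OF comm VAV n, of "w - \<mu>"] unfolding c_def by blast
    have inv: "is_inverse (U - w *\<^sub>C 1) W"
      using W(2) by (simp add: A_def complex.scale_left_diff_distrib)
    then show "w \<notin> spectrum U" by (auto simp: spectrum_def)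
    have "resolvent U w = W"
      unfolding resolvent_def using inv is_inverse_unique by blast
    with W(1) show "(\<lambda>k. (w - \<mu>) powi (int k - int n) *\<^sub>C c k) sums resolvent U w" by simp
  qed
  have "ball \<mu> r \<inter> spectrum U = {\<mu>}"
  proof
    show "ball \<mu> r \<inter> spectrum U \<subseteq> {\<mu>}" using regular by blast
    show "{\<mu>} \<subseteq> ball \<mu> r \<inter> spectrum U" using spec \<open>r > 0\<close> by simp
  qed
  then have "\<mu> isolated_in spectrum U"
    using spec unfolding isolated_in_def by blast
  moreover have "has_pole (resolvent U) \<mu>"
    unfolding has_pole_def using \<open>n > 0\<close> \<open>r > 0\<close> c0 laurent by blast
  ultimately show ?thesis by (simp add: resolvent_poles_def)
qed

lemma drazin_invertible_iff_regular_or_pole: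
  fixes U :: "'a::cbanach bop"
  shows "drazin_invertible (U - \<mu> *\<^sub>C 1) \<longleftrightarrow> \<mu> \<notin> spectrum U \<or> \<mu> \<in> resolvent_poles U"
proof
  assume "\<mu> \<notin> spectrum U \<or> \<mu> \<in> resolvent_poles U"
  then show "drazin_invertible (U - \<mu> *\<^sub>C 1)"
  proof
    assume "\<mu> \<notin> spectrum U"
    then obtain V where V: "is_inverse (U - \<mu> *\<^sub>C 1) V"
      unfolding spectrum_def by blast
    show ?thesis
      by (rule drazin_invertibleI[of _ V 0]) (use V in \<open>simp_all add: is_inverse_def\<close>)
  qed (rule drazin_invertible_if_pole)
qed (use resolvent_pole_if_drazin_invertible in blast)

lemma meromorphic_op_iff_drazin:
  fixes U :: "'a::cbanach bop"
  shows "meromorphic_op U \<longleftrightarrow> (\<forall>\<mu>. \<mu> \<noteq> 0 \<longrightarrow> drazin_invertible (U - \<mu> *\<^sub>C 1))"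
  unfolding meromorphic_op_def drazin_invertible_iff_regular_or_pole by auto

section \<open>Multiplication operators\<close>

lemma lmult_diff_scaleC_one: "lmult T - \<mu> *\<^sub>C 1 = lmult (T - \<mu> *\<^sub>C 1)"
  and rmult_diff_scaleC_one: "rmult T - \<mu> *\<^sub>C 1 = rmult (T - \<mu> *\<^sub>C 1)"
  by (rule bop_eqI, simp add: bop_apply_scaleC bop_apply_lmult bop_apply_rmult
      left_diff_distrib right_diff_distrib scaleC_times_left scaleC_times_right)+

lemma lmult_rmult_commute: "lmult A * rmult B = rmult B * lmult A"
  by (rule bop_eqI) (simp add: bop_apply_times bop_apply_lmult bop_apply_rmult mult.assoc)

lemma bop_apply_lmult_power: "bop_apply (lmult A ^ m) S = A ^ m * S"
  by (induction m) (simp_all add: bop_apply_times bop_apply_lmult mult.assoc)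

lemma bop_apply_rmult_power: "bop_apply (rmult A ^ m) S = S * A ^ m"
  by (induction m) (simp_all add: bop_apply_times bop_apply_rmult mult.assoc power_commutes)

text \<open>
  Passing from \<open>A\<close> to \<open>lmult A\<close> is the functoriality of the weak criterion. For the converse, let \<open>W\<close>
  be the Drazin inverse of \<open>lmult A\<close>. It commutes with \<open>lmult A\<close> and, lying in the bicommutant, with
  \<open>rmult A\<close>. Evaluating at 1 gives \<open>W(A) = A b\<close> and \<open>W(A) = b A\<close> for \<open>b = W(1)\<close>, so \<open>b\<close>
  commutes with \<open>A\<close> although \<open>W\<close> is not yet known to be a multiplication operator.
\<close>
lemma drazin_invertible_lmult_iff:
  fixes A :: "'a::complex_normed_vector bop"
  shows "drazin_invertible (lmult A) \<longleftrightarrow> drazin_invertible A"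
proof
  assume "drazin_invertible A"
  then obtain V m where V: "V \<in> bicommutant A" and m: "A ^ m * (1 - A * V) = 0"
    by (rule drazin_invertibleE)
  have comm: "A * V = V * A" using V by (rule bicommutant_self)
  show "drazin_invertible (lmult A)"
  proof (rule drazin_invertibleI)
    show "lmult A * lmult V = lmult V * lmult A"
      by (rule bop_eqI) (simp add: bop_apply_times bop_apply_lmult comm flip: mult.assoc)
    show "lmult A ^ m * (1 - lmult A * lmult V) = 0"
    proof (rule bop_eqI)
      fix S
      have "A ^ m * (1 - A * V) * S = 0" by (simp only: m mult_zero_left)
      then show "bop_apply (lmult A ^ m * (1 - lmult A * lmult V)) S = bop_apply 0 S"
        by (simp add: bop_apply_times bop_apply_lmult_power bop_apply_lmult
            left_diff_distrib right_diff_distrib mult.assoc)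
    qed
  qed
next
  assume "drazin_invertible (lmult A)"
  then obtain W m where W: "W \<in> bicommutant (lmult A)" and m: "lmult A ^ m * (1 - lmult A * W) = 0"
    by (rule drazin_invertibleE)
  define b where "b = bop_apply W 1"
  have "lmult A * W = W * lmult A" by (rule bicommutant_self[OF W])
  from arg_cong[OF this, of "\<lambda>f. bop_apply f 1"] have 1: "bop_apply W A = A * b"
    by (simp add: bop_apply_times bop_apply_lmult b_def)
  have "rmult A * W = W * rmult A"
    by (rule bicommutant_commute[OF W]) (simp add: lmult_rmult_commute)
  from arg_cong[OF this, of "\<lambda>f. bop_apply f 1"] have 2: "bop_apply W A = b * A"
    by (simp add: bop_apply_times bop_apply_rmult b_def)
  have "A ^ m * (1 - A * b) = 0"
    using arg_cong[OF m, of "\<lambda>f. bop_apply f 1"]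
    by (simp add: bop_apply_times bop_apply_lmult_power bop_apply_lmult b_def right_diff_distrib)
  with 1 2 show "drazin_invertible A"
    by (intro drazin_invertibleI[of A b]) simp_all
qed

text \<open>
  The mirror image. As \<open>rmult\<close> reverses products, the annihilation relation appears with its factors
  in the opposite order, which is harmless because they commute.
\<close>
lemma drazin_invertible_rmult_iff:
  fixes A :: "'a::complex_normed_vector bop"
  shows "drazin_invertible (rmult A) \<longleftrightarrow> drazin_invertible A"
proof
  assume "drazin_invertible A"
  then obtain V m where V: "V \<in> bicommutant A" and m: "A ^ m * (1 - A * V) = 0"
    by (rule drazin_invertibleE)
  have comm: "A * V = V * A" using V by (rule bicommutant_self)
  have "(1 - A * V) * A ^ m = A ^ m * (1 - A * V)"
    by (rule power_commuting_commutes[symmetric])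
      (simp add: left_diff_distrib right_diff_distrib mult.assoc flip: comm)
  with m have m': "(1 - A * V) * A ^ m = 0" by simp
  show "drazin_invertible (rmult A)"
  proof (rule drazin_invertibleI)
    show "rmult A * rmult V = rmult V * rmult A"
      by (rule bop_eqI) (simp add: bop_apply_times bop_apply_rmult comm mult.assoc)
    show "rmult A ^ m * (1 - rmult A * rmult V) = 0"
    proof (rule bop_eqI)
      fix S
      have "S * ((1 - A * V) * A ^ m) = 0" by (simp only: m' mult_zero_right)
      then show "bop_apply (rmult A ^ m * (1 - rmult A * rmult V)) S = bop_apply 0 S"
        by (simp add: bop_apply_times bop_apply_rmult_power bop_apply_rmult
            left_diff_distrib right_diff_distrib mult.assoc comm)
    qed
  qed
next
  assume "drazin_invertible (rmult A)"
  then obtain W m where W: "W \<in> bicommutant (rmult A)" and m: "rmult A ^ m * (1 - rmult A * W) = 0"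
    by (rule drazin_invertibleE)
  define b where "b = bop_apply W 1"
  have "rmult A * W = W * rmult A" by (rule bicommutant_self[OF W])
  from arg_cong[OF this, of "\<lambda>f. bop_apply f 1"] have 1: "bop_apply W A = b * A"
    by (simp add: bop_apply_times bop_apply_rmult b_def)
  have "lmult A * W = W * lmult A"
    by (rule bicommutant_commute[OF W]) (simp add: lmult_rmult_commute)
  from arg_cong[OF this, of "\<lambda>f. bop_apply f 1"] have 2: "bop_apply W A = A * b"
    by (simp add: bop_apply_times bop_apply_lmult b_def)
  have comm: "A * b = b * A" using 1 2 by simp
  have "(1 - A * b) * A ^ m = A ^ m * (1 - A * b)"
    by (rule power_commuting_commutes[symmetric])
      (simp add: left_diff_distrib right_diff_distrib mult.assoc flip: comm)
  moreover have "(1 - A * b) * A ^ m = 0"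
    using arg_cong[OF m, of "\<lambda>f. bop_apply f 1"]
    by (simp add: bop_apply_times bop_apply_rmult_power bop_apply_rmult comm left_diff_distrib mult.assoc
        flip: b_def)
  ultimately show "drazin_invertible A"
    using comm by (intro drazin_invertibleI[of A b m]) simp_all
qed

section \<open>Products in either order\<close>

text \<open>
  Jacobson's observation: if \<open>1 - ab\<close> has the inverse \<open>x\<close>, then \<open>1 - ba\<close> has the inverse \<open>1 + b x a\<close>.
  For \<open>\<alpha> = ab - \<mu>\<close> the corresponding element is \<open>y = \<mu>\<^sup>-\<^sup>1 (b x a - 1)\<close>. If \<open>x\<close> is only a
  weak inverse of \<open>\<alpha>\<close>, with defect \<open>1 - \<alpha> x\<close>, then the defect of \<open>y\<close> with respect to
  \<open>\<beta> = ba - \<mu>\<close> is \<open>\<mu>\<^sup>-\<^sup>1 b (1 - \<alpha> x) a\<close>. As \<open>\<beta> b = b \<alpha>\<close>, the power of \<open>\<alpha>\<close> that annihilates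
  the first defect, taken of \<open>\<beta>\<close>, annihilates the second.
\<close>
lemma drazin_invertible_swap:
  fixes a b :: "'a::complex_normed_vector bop"
  assumes "\<mu> \<noteq> 0" and "drazin_invertible (a * b - \<mu> *\<^sub>C 1)"
  shows "drazin_invertible (b * a - \<mu> *\<^sub>C 1)"
proof -
  define \<alpha> where "\<alpha> = a * b - \<mu> *\<^sub>C 1"
  define \<beta> where "\<beta> = b * a - \<mu> *\<^sub>C 1"
  obtain x m where x: "x \<in> bicommutant \<alpha>" and m: "\<alpha> ^ m * (1 - \<alpha> * x) = 0"
    using assms(2) unfolding \<alpha>_def[symmetric] by (rule drazin_invertibleE)
  have comm: "\<alpha> * x = x * \<alpha>" using x by (rule bicommutant_self)
  have \<beta>b: "\<beta> * b = b * \<alpha>" and a\<beta>: "a * \<beta> = \<alpha> * a"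
    by (simp_all add: \<alpha>_def \<beta>_def left_diff_distrib right_diff_distrib mult.assoc
        scaleC_times_left scaleC_times_right)
  define y where "y = inverse \<mu> *\<^sub>C (b * x * a - 1)"
  have ba: "b * a = \<beta> + \<mu> *\<^sub>C 1" by (simp add: \<beta>_def)
  have "\<beta> * (b * x * a - 1) = b * (\<alpha> * x) * a - \<beta>"
  proof -
    have "\<beta> * (b * x * a - 1) = \<beta> * b * x * a - \<beta>"
      by (simp add: right_diff_distrib mult.assoc)
    then show ?thesis by (simp only: \<beta>b mult.assoc)
  qed
  also have "\<dots> = \<mu> *\<^sub>C 1 - b * (1 - \<alpha> * x) * a"
    by (simp add: left_diff_distrib right_diff_distrib ba)
  finally have \<beta>bxa: "\<beta> * (b * x * a - 1) = \<mu> *\<^sub>C 1 - b * (1 - \<alpha> * x) * a" .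
  have \<beta>y: "\<beta> * y = 1 - inverse \<mu> *\<^sub>C (b * (1 - \<alpha> * x) * a)"
  proof -
    have "\<beta> * y = inverse \<mu> *\<^sub>C (\<beta> * (b * x * a - 1))"
      by (simp only: y_def scaleC_times_right)
    also have "\<dots> = inverse \<mu> *\<^sub>C \<mu> *\<^sub>C 1 - inverse \<mu> *\<^sub>C (b * (1 - \<alpha> * x) * a)"
      by (simp only: \<beta>bxa complex.scale_right_diff_distrib)
    finally show ?thesis using \<open>\<mu> \<noteq> 0\<close> by simp
  qed
  have "(b * x * a - 1) * \<beta> = b * (x * \<alpha>) * a - \<beta>"
    by (simp add: left_diff_distrib mult.assoc a\<beta>)
  also have "\<dots> = \<beta> * (b * x * a - 1)"
    unfolding \<open>\<beta> * (b * x * a - 1) = b * (\<alpha> * x) * a - \<beta>\<close> comm ..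
  finally have "\<beta> * y = y * \<beta>"
    by (simp add: y_def scaleC_times_left scaleC_times_right)
  moreover have "\<beta> ^ m * (1 - \<beta> * y) = 0"
  proof -
    have "\<beta> ^ k * b = b * \<alpha> ^ k" for k
    proof (induction k)
      case (Suc k)
      have "\<beta> ^ Suc k * b = \<beta> ^ k * (\<beta> * b)" by (simp only: power_Suc2 mult.assoc)
      also have "\<dots> = \<beta> ^ k * b * \<alpha>" by (simp only: \<beta>b mult.assoc)
      also have "\<dots> = b * \<alpha> ^ Suc k" by (simp only: Suc power_Suc2 mult.assoc)
      finally show ?case .
    qed simp
    then have "\<beta> ^ m * (b * (1 - \<alpha> * x) * a) = b * (\<alpha> ^ m * (1 - \<alpha> * x)) * a"
      by (simp only: mult.assoc[symmetric])
    then show ?thesis by (simp add: \<beta>y m scaleC_times_right)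
  qed
  ultimately show ?thesis
    unfolding \<beta>_def[symmetric] by (rule drazin_invertibleI)
qed

section \<open>Commuting perturbations with a power of finite rank\<close>

text \<open>
  The form \<open>1 - B v\<close> is preserved by products. Up to a scalar factor, every nonzero polynomial in
  \<open>B\<close> is a power of \<open>B\<close> times an element of this form, and the weak criterion asks that such a
  product vanish. Multiplying several partial annihilators thus stays within its scope.
\<close>
lemma one_minus_mult_product:
  fixes B v w :: "'a::{ring, monoid_mult}"
  shows "(1 - B * v) * (1 - B * w) = 1 - B * (v + w - v * B * w)"
  by (simp add: algebra_simps)

lemma one_minus_mult_power:
  fixes B v :: "'a::{ring, monoid_mult}"
  assumes "v * B = B * v"
  shows "\<exists>u. u * B = B * u \<and> (1 - B * v) ^ n = 1 - B * u"
proof (induction n)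
  case 0
  show ?case by (rule exI[of _ 0]) simp
next
  case (Suc n)
  then obtain u where u: "u * B = B * u" "(1 - B * v) ^ n = 1 - B * u" by blast
  have "(v + u - v * B * u) * B = B * (v + u - v * B * u)"
    by (simp add: left_diff_distrib right_diff_distrib distrib_left distrib_right mult.assoc
        assms u(1) left_commute_of_commute[OF assms])
  with one_minus_mult_product[of B v u] u(2) show ?case
    by (intro exI[of _ "v + u - v * B * u"]) simp
qed

text \<open>
  The orbit of \<open>b\<close> under \<open>B\<close> lies in a finite-dimensional space, so some \<open>B ^ k b\<close> is a combination
  of \<^emph>\<open>later\<close> members of the orbit. Choosing the earliest term of a linear relation in this way
  yields the relation in the normalized form \<open>B ^ k (1 - B w) b = 0\<close> with \<open>w\<close> a polynomial in \<open>B\<close>.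
\<close>
lemma orbit_annihilator:
  fixes B :: "'a::complex_normed_vector bop" and b :: 'a
  assumes S: "finite S" and orbit: "\<And>i. bop_apply (B ^ i) b \<in> complex.span S"
  shows "\<exists>k. \<exists>w \<in> bicommutant B. bop_apply (B ^ k * (1 - B * w)) b = 0"
proof -
  define e where "e i = bop_apply (B ^ i) b" for i
  have "\<exists>k. e k \<in> complex.span (e ` {k<..})"
  proof (rule ccontr)
    assume "\<not> ?thesis"
    \<comment> \<open>each vector is independent of its successors, so adding vectors from \<open>e (N - 1)\<close> backwards
      produces more independent vectors than the span of \<open>S\<close> admits\<close>
    then have new: "e k \<notin> complex.span (e ` {k<..})" for k by blast
    define N where "N = Suc (card S)"
    have "complex.independent (e ` {N - d..<N}) \<and> card (e ` {N - d..<N}) = d" if "d \<le> N" for d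
      using that
    proof (induction d)
      case 0
      then show ?case by (simp add: complex.independent_empty)
    next
      case (Suc d)
      define k where "k = N - Suc d"
      have k: "{N - Suc d..<N} = insert k {N - d..<N}" "{N - d..<N} \<subseteq> {k<..}"
        using Suc.prems by (auto simp: k_def)
      have "e k \<notin> complex.span (e ` {N - d..<N})"
        using new[of k] subsetD[OF complex.span_mono[OF image_mono[OF k(2)]]] by metis
      moreover from this have "e k \<notin> e ` {N - d..<N}"
        using complex.span_base by metis
      moreover have "complex.independent (e ` {N - d..<N})" "card (e ` {N - d..<N}) = d"
        using Suc by simp_all
      ultimately show ?case
        unfolding k(1) image_insert by (simp add: complex.independent_insert)
    qed
    from this[of N] have "complex.independent (e ` {0..<N})" "card (e ` {0..<N}) = N"
      by simp_all
    moreover have "e ` {0..<N} \<subseteq> complex.span S"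
      using orbit by (auto simp: e_def)
    ultimately show False
      using complex.independent_span_bound[OF S, of "e ` {0..<N}"] by (simp add: N_def)
  qed
  then obtain k where k: "e k \<in> complex.span (e ` {k<..})" by blast
  have "\<exists>w \<in> bicommutant B. x = bop_apply (B ^ Suc k * w) b" if "x \<in> complex.span (e ` {k<..})" for x
    using that
  proof (induction rule: complex.span_induct_alt)
    case base
    show ?case by (rule bexI[of _ 0]) (simp_all add: bicommutant_closed)
  next
    case (step c x y)
    then obtain i w where i: "k < i" "x = e i" and w: "w \<in> bicommutant B" "y = bop_apply (B ^ Suc k * w) b"
      by blast
    define j where "j = i - Suc k"
    have "i = Suc k + j" using i by (simp add: j_def)
    then have "x = bop_apply (B ^ Suc k * B ^ j) b"
      by (simp only: i(2) e_def power_add)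
    then have "c *\<^sub>C x + y = bop_apply (B ^ Suc k * (c *\<^sub>C B ^ j + w)) b"
      by (simp only: w(2) distrib_left scaleC_times_right bop_apply_scaleC bop_apply_simps)
    moreover have "c *\<^sub>C B ^ j + w \<in> bicommutant B"
      using w(1) by (simp add: bicommutant_closed bicommutant_scaleC)
    ultimately show ?case by blast
  qed
  then obtain w where w: "w \<in> bicommutant B" "e k = bop_apply (B ^ Suc k * w) b"
    using k by blast
  have "B ^ k * (1 - B * w) = B ^ k - B ^ Suc k * w"
    by (simp only: right_diff_distrib mult_1_right power_Suc2 mult.assoc)
  then have "bop_apply (B ^ k * (1 - B * w)) b = 0"
    using w(2) by (simp only: e_def bop_apply_simps diff_self)
  with w(1) show ?thesis by blast
qed

text \<open>
  The annihilators of the finitely many generators commute, so their product annihilates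
  all of them, and by linearity the whole span.
\<close>
lemma span_annihilator:
  fixes B :: "'a::complex_normed_vector bop"
  assumes S: "finite S" and inv: "\<And>i b. b \<in> S \<Longrightarrow> bop_apply (B ^ i) b \<in> complex.span S"
  shows "\<exists>k. \<exists>w \<in> bicommutant B. \<forall>x \<in> complex.span S. bop_apply (B ^ k * (1 - B * w)) x = 0"
proof -
  have "\<exists>k. \<exists>w \<in> bicommutant B. \<forall>b \<in> S'. bop_apply (B ^ k * (1 - B * w)) b = 0"
    if "finite S'" "S' \<subseteq> S" for S'
    using that
  proof (induction S')
    case empty
    show ?case using bicommutant_closed(2) by blast
  next
    case (insert b S')
    then obtain k w where w: "w \<in> bicommutant B"
      and kw: "\<And>x. x \<in> S' \<Longrightarrow> bop_apply (B ^ k * (1 - B * w)) x = 0" by blast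
    have "b \<in> S" using insert by simp
    then obtain l u where u: "u \<in> bicommutant B" and lu: "bop_apply (B ^ l * (1 - B * u)) b = 0"
      using orbit_annihilator[OF S inv] by blast
    define f g where "f = B ^ k * (1 - B * w)" and "g = B ^ l * (1 - B * u)"
    have fB: "f \<in> bicommutant B" and gB: "g \<in> bicommutant B"
      unfolding f_def g_def using u w by (auto intro!: bicommutant_closed)
    have fg: "f * g = g * f"
      by (rule bicommutant_commute[OF gB]) (simp add: bicommutant_self[OF fB])
    have wB: "w * B = B * w" by (simp add: bicommutant_self[OF w])
    have wl: "(1 - B * w) * B ^ l = B ^ l * (1 - B * w)"
      by (rule power_commuting_commutes[symmetric])
        (simp add: left_diff_distrib right_diff_distrib mult.assoc wB)
    have "f * g = B ^ k * (B ^ l * ((1 - B * w) * (1 - B * u)))"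
      unfolding f_def g_def by (simp only: mult.assoc left_commute_of_commute[OF wl])
    also have "\<dots> = B ^ (k + l) * (1 - B * (w + u - w * B * u))"
      by (simp only: one_minus_mult_product power_add mult.assoc)
    finally have "f * g = B ^ (k + l) * (1 - B * (w + u - w * B * u))" .
    moreover have "\<forall>x\<in>insert b S'. bop_apply (f * g) x = 0"
    proof
      fix x assume "x \<in> insert b S'"
      then show "bop_apply (f * g) x = 0"
      proof
        assume "x = b"
        then show ?thesis using lu by (simp add: bop_apply_times g_def)
      next
        assume "x \<in> S'"
        then have "bop_apply f x = 0" using kw by (simp only: f_def)
        then show ?thesis by (simp only: fg bop_apply_times bop_apply_simps)
      qed
    qed
    moreover have "w + u - w * B * u \<in> bicommutant B"
      using u w by (auto intro!: bicommutant_closed)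
    ultimately show ?case by metis
  qed
  from this[OF S order_refl] obtain k w where w: "w \<in> bicommutant B"
    and kw: "\<And>b. b \<in> S \<Longrightarrow> bop_apply (B ^ k * (1 - B * w)) b = 0" by blast
  have "bop_apply (B ^ k * (1 - B * w)) x = 0" if "x \<in> complex.span S" for x
    using that
  proof (induction rule: complex.span_induct_alt)
    case (step c x y)
    then show ?case using kw by (simp add: bop_apply_scaleC_arg)
  qed simp
  with w show ?thesis by blast
qed

text \<open>The binomial expansion modulo \<open>F\<close>. The cofactor of \<open>F\<close> has to commute with \<open>F\<close> so that
  the \<open>n\<close>-th power of a multiple of \<open>F\<close> becomes a multiple of \<open>F ^ n\<close>.\<close>
lemma power_add_eq_mod:
  fixes A F :: "'a::{ring, monoid_mult}"
  assumes "A * F = F * A"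
  shows "\<exists>r. r * F = F * r \<and> (A + F) ^ m = A ^ m + F * r"
proof (induction m)
  case 0
  show ?case by (rule exI[of _ 0]) simp
next
  case (Suc m)
  then obtain r where r: "r * F = F * r" "(A + F) ^ m = A ^ m + F * r" by blast
  have AmF: "A ^ m * F = F * A ^ m"
    using assms by (rule power_commuting_commutes)
  have "(A + F) ^ Suc m = A ^ Suc m + F * (A ^ m + A * r + F * r)"
    by (simp add: r(2) distrib_left distrib_right add_ac mult.assoc left_commute_of_commute[OF assms])
  moreover have "(A ^ m + A * r + F * r) * F = F * (A ^ m + A * r + F * r)"
    by (simp add: distrib_left distrib_right mult.assoc r(1) AmF left_commute_of_commute[OF assms])
  ultimately show ?case by blast
qed

text \<open>
  With \<open>q = 1 - A v\<close>, the defect of \<open>v\<close> for \<open>B = A + F\<close> is \<open>1 - B v = q - F v\<close>. Since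
  \<open>A ^ m q = 0\<close> and \<open>B ^ m\<close> agrees with \<open>A ^ m\<close> modulo \<open>F\<close>, the product \<open>B ^ m (1 - B v)\<close> is a
  multiple \<open>F s\<close>, and its \<open>n\<close>-th power is \<open>F ^ n s ^ n\<close>. An element \<open>B ^ k (1 - B w)\<close> that
  vanishes on the range of \<open>F ^ n\<close> annihilates this power, and the product of the two is of the
  form required by the weak criterion.
\<close>
lemma drazin_invertible_add_power_finite_rank:
  fixes A F :: "'a::complex_normed_vector bop"
  assumes "drazin_invertible A" and AF: "A * F = F * A" and fin: "finite_dim_range (F ^ n)"
  shows "drazin_invertible (A + F)"
proof -
  define B where "B = A + F"
  obtain v m where v: "v \<in> bicommutant A" and m: "A ^ m * (1 - A * v) = 0"
    using assms(1) by (rule drazin_invertibleE)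
  have vF: "v * F = F * v"
    by (rule bicommutant_commute[OF v, symmetric]) (simp add: AF)
  have vA: "v * A = A * v" by (simp add: bicommutant_self[OF v])
  have vB: "v * B = B * v" by (simp add: B_def distrib_left distrib_right vA vF)
  have BF: "B * F = F * B" by (simp add: B_def distrib_left distrib_right AF)
  obtain r where r: "r * F = F * r" "B ^ m = A ^ m + F * r"
    using power_add_eq_mod[OF AF, of m] unfolding B_def by blast
  define q where "q = 1 - A * v"
  define s where "s = r * q - B ^ m * v"
  have qF: "q * F = F * q"
    by (simp add: q_def left_diff_distrib right_diff_distrib mult.assoc vF left_commute_of_commute[OF AF])
  have BmF: "B ^ m * F = F * B ^ m"
    using BF by (rule power_commuting_commutes)
  have Fs: "F * s = s * F"
    by (simp add: s_def left_diff_distrib right_diff_distrib mult.assoc qF vF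
        left_commute_of_commute[OF r(1)] left_commute_of_commute[OF BmF])
  have "B ^ m * (1 - B * v) = B ^ m * q - B ^ m * (F * v)"
    by (simp add: q_def B_def algebra_simps)
  also have "B ^ m * q = F * r * q"
    by (simp add: r(2) distrib_right) (simp add: m q_def)
  also have "F * r * q - B ^ m * (F * v) = F * s"
    by (simp add: s_def right_diff_distrib mult.assoc left_commute_of_commute[OF BmF])
  finally have step: "B ^ m * (1 - B * v) = F * s" .
  have Bm: "B ^ m * (1 - B * v) = (1 - B * v) * B ^ m"
    by (rule power_commuting_commutes)
      (simp add: left_diff_distrib right_diff_distrib mult.assoc vB)
  have near: "B ^ (m * n) * (1 - B * v) ^ n = F ^ n * s ^ n"
    using arg_cong[OF step, of "\<lambda>x. x ^ n"]
    by (simp only: power_mult_commuting[OF Bm] power_mult_commuting[OF Fs] power_mult)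
  obtain S where S: "finite S" "range (bop_apply (F ^ n)) = complex.span S"
    using fin unfolding finite_dim_range_def by blast
  have "bop_apply (B ^ i) b \<in> complex.span S" if b: "b \<in> S" for i b
  proof -
    obtain x where x: "b = bop_apply (F ^ n) x"
      using b complex.span_base S(2) by blast
    have FnB: "F ^ n * B = B * F ^ n"
      by (rule power_commuting_commutes) (simp add: BF)
    have "B ^ i * F ^ n = F ^ n * B ^ i"
      by (rule power_commuting_commutes) (simp add: FnB)
    then have "bop_apply (B ^ i) b = bop_apply (F ^ n) (bop_apply (B ^ i) x)"
      by (simp add: x flip: bop_apply_times)
    then show ?thesis using S(2) by blast
  qed
  then obtain k w where w: "w \<in> bicommutant B"
    and kill: "\<And>x. x \<in> complex.span S \<Longrightarrow> bop_apply (B ^ k * (1 - B * w)) x = 0"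
    using span_annihilator[OF S(1)] by blast
  have "B ^ k * (1 - B * w) * F ^ n = 0"
    by (rule bop_eqI) (use kill S(2) in \<open>auto simp: bop_apply_times[of _ "F ^ n"]\<close>)
  then have zero: "B ^ k * (1 - B * w) * (B ^ (m * n) * (1 - B * v) ^ n) = 0"
    unfolding near by (simp only: mult.assoc[symmetric] mult_zero_left)
  obtain u where u: "u * B = B * u" "(1 - B * v) ^ n = 1 - B * u"
    using one_minus_mult_power[OF vB] by blast
  have wB: "w * B = B * w" by (simp add: bicommutant_self[OF w])
  have wl: "(1 - B * w) * B ^ (m * n) = B ^ (m * n) * (1 - B * w)"
    by (rule power_commuting_commutes[symmetric])
      (simp add: left_diff_distrib right_diff_distrib mult.assoc wB)
  have "B ^ (k + m * n) * ((1 - B * w) * (1 - B * u)) = 0"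
    using zero unfolding u(2) by (simp only: power_add mult.assoc left_commute_of_commute[OF wl])
  then have "B ^ (k + m * n) * (1 - B * (w + u - w * B * u)) = 0"
    by (simp only: one_minus_mult_product)
  moreover have "B * (w + u - w * B * u) = (w + u - w * B * u) * B"
    by (simp add: left_diff_distrib right_diff_distrib distrib_left distrib_right mult.assoc
        wB u(1) left_commute_of_commute[OF wB])
  ultimately show ?thesis
    unfolding B_def[symmetric] by (intro drazin_invertibleI)
qed

section \<open>Meromorphic operators\<close>

theorem theorem3p1:
  fixes T :: "'a::cbanach bop"
  shows "((meromorphic_op T \<longleftrightarrow> drazin_spectrum T \<subseteq> {0}) \<and>
          (meromorphic_op T \<longleftrightarrow> meromorphic_op (lmult T)) \<and>
          (meromorphic_op T \<longleftrightarrow> meromorphic_op (rmult T))) \<and>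
         (\<forall>S :: 'a bop. meromorphic_op (S * T) \<longleftrightarrow> meromorphic_op (T * S)) \<and>
         (\<forall>F :: 'a bop. (\<exists>n::nat. n > 0 \<and> finite_dim_range (F ^ n)) \<and> F * T = T * F \<longrightarrow>
            meromorphic_op T \<longrightarrow> meromorphic_op (T + F))"
proof (intro conjI allI impI)
  show "meromorphic_op T \<longleftrightarrow> drazin_spectrum T \<subseteq> {0}"
    by (auto simp: meromorphic_op_iff_drazin drazin_spectrum_def)
  show "meromorphic_op T \<longleftrightarrow> meromorphic_op (lmult T)"
    by (simp add: meromorphic_op_iff_drazin lmult_diff_scaleC_one drazin_invertible_lmult_iff)
  show "meromorphic_op T \<longleftrightarrow> meromorphic_op (rmult T)"
    by (simp add: meromorphic_op_iff_drazin rmult_diff_scaleC_one drazin_invertible_rmult_iff)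
  show "meromorphic_op (S * T) \<longleftrightarrow> meromorphic_op (T * S)" for S :: "'a bop"
    unfolding meromorphic_op_iff_drazin using drazin_invertible_swap by metis
next
  fix F :: "'a bop"
  assume "(\<exists>n::nat. n > 0 \<and> finite_dim_range (F ^ n)) \<and> F * T = T * F" and T: "meromorphic_op T"
  then obtain n where fin: "finite_dim_range (F ^ n)" and comm: "F * T = T * F" by blast
  show "meromorphic_op (T + F)"
    unfolding meromorphic_op_iff_drazin
  proof (intro allI impI)
    fix \<mu> :: complex assume "\<mu> \<noteq> 0"
    then have "drazin_invertible (T - \<mu> *\<^sub>C 1)"
      using T by (simp add: meromorphic_op_iff_drazin)
    from drazin_invertible_add_power_finite_rank[OF this commute_diff_scaleC_one[OF comm, symmetric] fin]
    show "drazin_invertible (T + F - \<mu> *\<^sub>C 1)"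
      by (simp add: algebra_simps)
  qed
qed

end
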